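(* Let $f,g:[a,b]\to\mathbb{R}$ be integrable functions such that $0\le g(t)\le 1$ for all $t\in[a,b]$ and such that $\int_a^b g(t)\,df(t)$ exists. Put $\lambda:=\int_a^b g(t)\,dt$. If $f$ is $L$-Lipschitzian on $[a,b]$, then $$\left|\int_a^{a+\lambda} f(t)\,dt-\int_a^b f(t)g(t)\,dt\right|\le\frac{L}{2}\left[(b-a-\lambda)^2+\lambda^2\right],$$ and $$\left|\int_a^b f(t)g(t)\,dt-\int_{b-\lambda}^b f(t)\,dt\right|\le\frac{L}{2}\left[(b-a-\lambda)^2+\lambda^2\right].$$
   Context: Here $a<b$ are real numbers, $\int_a^b g(t)\,df(t)$ denotes the Riemann–Stieltjes integral of $g$ with respect to $f$, and $f$ being $L$-Lipschitzian on $[a,b]$ means $|f(x)-f(y)|\le L|x-y|$ for all $x,y\in[a,b]$. *)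

theory Defs
  imports "HOL-Analysis.Analysis"
begin

text \<open>
  Riemann--Stieltjes integral of \<open>g\<close> with respect to \<open>f\<close>, as the limit of
  \<open>\<Sum> g(\<xi>\<^sub>i) (f(x\<^sub>i\<^sub>+\<^sub>1) - f(x\<^sub>i))\<close> as the mesh of the tagged partition tends to 0.
  Each cell \<open>K\<close> is a compact interval containing its tag, so \<open>Inf K\<close> and
  \<open>Sup K\<close> are its endpoints; degenerate cells are permitted but contribute 0.
\<close>

definition has_RS_integral ::
    "(real \<Rightarrow> real) \<Rightarrow> (real \<Rightarrow> real) \<Rightarrow> real \<Rightarrow> real \<Rightarrow> real \<Rightarrow> bool" where
  "has_RS_integral g f a b I \<longleftrightarrow>
     (\<forall>e>0. \<exists>d>0. \<forall>p. p tagged_division_of {a..b} \<longrightarrow>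
        (\<forall>(x, K)\<in>p. Sup K - Inf K < d) \<longrightarrow>
        \<bar>(\<Sum>(x, K)\<in>p. g x * (f (Sup K) - f (Inf K))) - I\<bar> < e)"

definition RS_integrable ::
    "(real \<Rightarrow> real) \<Rightarrow> (real \<Rightarrow> real) \<Rightarrow> real \<Rightarrow> real \<Rightarrow> bool" where
  "RS_integrable g f a b \<longleftrightarrow> (\<exists>I. has_RS_integral g f a b I)"

end

theory Submission
  imports Defs
begin

text \<open>
  Both differences have the form \<open>\<integral> f h\<close>, where \<open>h\<close> is (up to sign) the indicator of an interval of
  length \<open>\<lambda>\<close> minus \<open>g\<close>. Then \<open>\<bar>h\<bar> \<le> 1\<close> and \<open>\<integral> h = 0\<close>, so \<open>f\<close> may be replaced by \<open>f - f c\<close>, where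
  \<open>c\<close> is \<open>a + \<lambda>\<close> or \<open>b - \<lambda>\<close>; the Lipschitz condition bounds the integral by \<open>L \<integral> \<bar>t - c\<bar> dt\<close>.
\<close>

text \<open>Splitting at \<open>c\<close>, where \<open>t - c\<close> changes sign, leaves a linear
  integrand on each side.\<close>

lemma has_integral_abs_diff:
  fixes a b c :: real
  assumes "a \<le> c" "c \<le> b"
  shows "((\<lambda>t. \<bar>t - c\<bar>) has_integral ((c - a)\<^sup>2 + (b - c)\<^sup>2) / 2) {a..b}"
proof -
  \<comment> \<open>The vanishing term is written out so that the two endpoint values determine the
    antiderivative \<open>- (c - t)\<^sup>2 / 2\<close> by unification.\<close>
  have "((\<lambda>t. c - t) has_integral (- (c - c)\<^sup>2 / 2) - (- (c - a)\<^sup>2 / 2)) {a..c}"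
    by (rule fundamental_theorem_of_calculus)
      (use assms in \<open>auto intro!: derivative_eq_intros
        simp: has_real_derivative_iff_has_vector_derivative[symmetric] field_simps\<close>)
  then have left: "((\<lambda>t. \<bar>t - c\<bar>) has_integral (c - a)\<^sup>2 / 2) {a..c}"
    by (subst has_integral_cong[where g = "\<lambda>t. c - t"]) auto
  have "((\<lambda>t. t - c) has_integral ((b - c)\<^sup>2 / 2) - ((c - c)\<^sup>2 / 2)) {c..b}"
    by (rule fundamental_theorem_of_calculus)
      (use assms in \<open>auto intro!: derivative_eq_intros
        simp: has_real_derivative_iff_has_vector_derivative[symmetric]\<close>)
  then have right: "((\<lambda>t. \<bar>t - c\<bar>) has_integral (b - c)\<^sup>2 / 2) {c..b}"
    by (subst has_integral_cong[where g = "\<lambda>t. t - c"]) auto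
  show ?thesis
    using has_integral_combine[OF assms left right] by (simp add: add_divide_distrib)
qed

text \<open>The bound upgrades \<open>h\<close> from gauge integrable to absolutely integrable, and
  absolute integrability survives multiplication by the bounded measurable function
  \<open>f\<close>.\<close>

lemma integrable_continuous_mult_bounded:
  fixes f h :: "real \<Rightarrow> real"
  assumes "continuous_on {a..b} f" "h integrable_on {a..b}"
    and "\<And>t. t \<in> {a..b} \<Longrightarrow> \<bar>h t\<bar> \<le> B"
  shows "(\<lambda>t. f t * h t) integrable_on {a..b}"
proof -
  have "h absolutely_integrable_on {a..b}"
    by (rule absolutely_integrable_integrable_bound[where g = "\<lambda>_. B"]) (use assms in auto)
  moreover have "bounded (f ` {a..b})"
    using assms(1) by (intro compact_imp_bounded compact_continuous_image) auto
  moreover have "f \<in> borel_measurable (lebesgue_on {a..b})"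
    using assms(1) by (intro continuous_imp_measurable_on_sets_lebesgue) auto
  ultimately have "(\<lambda>t. f t * h t) absolutely_integrable_on {a..b}"
    by (intro absolutely_integrable_bounded_measurable_product_real) auto
  then show ?thesis
    by (rule set_lebesgue_integral_eq_integral(1))
qed

lemma lipschitz_mean_zero_integral_bound:
  fixes f h :: "real \<Rightarrow> real"
  assumes c: "a \<le> c" "c \<le> b"
    and lip: "L-lipschitz_on {a..b} f"
    and h0: "(h has_integral 0) {a..b}"
    and h1: "\<And>t. t \<in> {a..b} \<Longrightarrow> \<bar>h t\<bar> \<le> 1"
  shows "\<bar>integral {a..b} (\<lambda>t. f t * h t)\<bar> \<le> L / 2 * ((c - a)\<^sup>2 + (b - c)\<^sup>2)"
proof -
  have L: "0 \<le> L"
    using lip by (rule lipschitz_on_nonneg)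
  have fh: "(\<lambda>t. f t * h t) integrable_on {a..b}"
    using lipschitz_on_continuous_on[OF lip] has_integral_integrable[OF h0] h1
    by (rule integrable_continuous_mult_bounded)
  \<comment> \<open>Since \<open>h\<close> has integral 0, subtracting the constant
    \<open>f c\<close> from \<open>f\<close> leaves the value of the integral unchanged.\<close>
  have "((\<lambda>t. f t * h t - f c * h t) has_integral integral {a..b} (\<lambda>t. f t * h t) - f c * 0) {a..b}"
    by (intro has_integral_diff has_integral_mult_right integrable_integral fh h0)
  then have centred:
    "((\<lambda>t. (f t - f c) * h t) has_integral integral {a..b} (\<lambda>t. f t * h t)) {a..b}"
    by (simp add: left_diff_distrib)
  have bound: "((\<lambda>t. L * \<bar>t - c\<bar>) has_integral L * (((c - a)\<^sup>2 + (b - c)\<^sup>2) / 2)) {a..b}"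
    by (intro has_integral_mult_right has_integral_abs_diff c)
  have "norm ((f t - f c) * h t) \<le> L * \<bar>t - c\<bar>" if t: "t \<in> {a..b}" for t
  proof -
    have "\<bar>f t - f c\<bar> \<le> L * \<bar>t - c\<bar>"
      using lipschitz_onD[OF lip t, of c] c by (simp add: dist_real_def)
    then have "\<bar>f t - f c\<bar> * \<bar>h t\<bar> \<le> L * \<bar>t - c\<bar> * 1"
      using h1[OF t] L by (intro mult_mono) auto
    then show ?thesis
      by (simp add: abs_mult)
  qed
  then have "norm (integral {a..b} (\<lambda>t. (f t - f c) * h t)) \<le> integral {a..b} (\<lambda>t. L * \<bar>t - c\<bar>)"
    using centred bound by (intro integral_norm_bound_integral) auto
  then show ?thesis
    by (simp only: integral_unique[OF centred] integral_unique[OF bound] real_norm_def)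
qed

text \<open>Serves both inequalities: \<open>{u..v}\<close> can sit at either end of
  \<open>{a..b}\<close>. The centre \<open>c\<close> stays free, because a mean-zero weight allows
  \<open>f\<close> to be centred at any point.\<close>

lemma steffensen_lipschitz_bound:
  fixes f g :: "real \<Rightarrow> real"
  assumes uv: "a \<le> u" "u \<le> v" "v \<le> b" and c: "a \<le> c" "c \<le> b"
    and g: "(g has_integral (v - u)) {a..b}"
    and g01: "\<And>t. t \<in> {a..b} \<Longrightarrow> 0 \<le> g t \<and> g t \<le> 1"
    and lip: "L-lipschitz_on {a..b} f"
  shows "\<bar>integral {u..v} f - integral {a..b} (\<lambda>t. f t * g t)\<bar>
           \<le> L / 2 * ((c - a)\<^sup>2 + (b - c)\<^sup>2)"
proof -
  have cont: "continuous_on {a..b} f"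
    using lip by (rule lipschitz_on_continuous_on)
  have sub: "{u..v} \<subseteq> {a..b}"
    using uv by auto
  \<comment> \<open>The interval has length \<open>v - u\<close>, which is also the integral of
    \<open>g\<close>; hence indicator minus \<open>g\<close> has mean zero.\<close>
  have "((\<lambda>_. 1::real) has_integral v - u) {u..v}"
    using has_integral_const_real[of "1::real" u v] uv by simp
  then have "((\<lambda>t. if t \<in> {u..v} then 1 else 0 :: real) has_integral v - u) {a..b}"
    by (simp only: has_integral_restrict[OF sub])
  from has_integral_diff[OF this g]
  have h0: "((\<lambda>t. (if t \<in> {u..v} then 1 else 0) - g t) has_integral 0) {a..b}"
    by simp
  have "(f has_integral integral {u..v} f) {u..v}"
    by (intro integrable_integral integrable_continuous_real continuous_on_subset[OF cont sub])
  then have fuv: "((\<lambda>t. if t \<in> {u..v} then f t else 0) has_integral integral {u..v} f) {a..b}"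
    by (simp only: has_integral_restrict[OF sub])
  have "(\<lambda>t. f t * g t) integrable_on {a..b}"
    by (rule integrable_continuous_mult_bounded[where B = 1])
      (use cont g g01 in \<open>auto simp: abs_le_iff intro: order_trans[of _ 0]\<close>)
  from has_integral_diff[OF fuv integrable_integral[OF this]]
  have "((\<lambda>t. f t * ((if t \<in> {u..v} then 1 else 0) - g t)) has_integral
      integral {u..v} f - integral {a..b} (\<lambda>t. f t * g t)) {a..b}"
    by (rule has_integral_eq[rotated]) (simp add: right_diff_distrib)
  \<comment> \<open>Indicator and \<open>g\<close> both take values in [0, 1], so they differ by at
    most 1.\<close>
  moreover have "\<bar>(if t \<in> {u..v} then 1 else 0) - g t\<bar> \<le> 1" if "t \<in> {a..b}" for t
    using g01[OF that] by auto
  then have "\<bar>integral {a..b} (\<lambda>t. f t * ((if t \<in> {u..v} then 1 else 0) - g t))\<bar>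
      \<le> L / 2 * ((c - a)\<^sup>2 + (b - c)\<^sup>2)"
    by (rule lipschitz_mean_zero_integral_bound[OF c lip h0])
  ultimately show ?thesis
    by (simp only: integral_unique)
qed

theorem theorem4:
  fixes f g :: "real \<Rightarrow> real" and a b L lam :: real
  assumes "a < b"
    and "f integrable_on {a..b}"
    and "g integrable_on {a..b}"
    and "\<And>t. t \<in> {a..b} \<Longrightarrow> 0 \<le> g t \<and> g t \<le> 1"
    and "RS_integrable g f a b"
    and "lam = integral {a..b} g"
    and "L-lipschitz_on {a..b} f"
  shows "\<bar>integral {a..a + lam} f - integral {a..b} (\<lambda>t. f t * g t)\<bar>
           \<le> L / 2 * ((b - a - lam)\<^sup>2 + lam\<^sup>2)
       \<and> \<bar>integral {a..b} (\<lambda>t. f t * g t) - integral {b - lam..b} f\<bar>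
           \<le> L / 2 * ((b - a - lam)\<^sup>2 + lam\<^sup>2)"
proof -
  have g: "(g has_integral lam) {a..b}"
    using assms(3,6) by (simp add: integrable_integral)
  \<comment> \<open>From 0 \<le> \<open>g\<close> \<le> 1 follows 0 \<le> \<open>lam\<close> \<le>
    \<open>b - a\<close>, which keeps both subintervals and both centres inside
    \<open>{a..b}\<close>.\<close>
  have "0 \<le> lam"
    using has_integral_nonneg[OF g] assms(4) by blast
  moreover have "lam \<le> b - a"
    using has_integral_le[OF g, of "\<lambda>_. 1" "b - a"] has_integral_const_real[of "1::real" a b]
      assms(1,4) by simp
  ultimately show ?thesis
    \<comment> \<open>Each centre is the inner endpoint of its subinterval. It cuts
      \<open>{a..b}\<close> into pieces of lengths \<open>lam\<close> and
      \<open>b - a - lam\<close>, in opposite orders, so the two bounds agree.\<close>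
    using steffensen_lipschitz_bound[of a a "a + lam" b "a + lam" g L f]
      steffensen_lipschitz_bound[of a "b - lam" b b "b - lam" g L f] g assms(1,4,7)
    by (simp add: add.commute abs_minus_commute algebra_simps)
qed

end
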